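(* Let $\mathbf u=(u_n)_{n\in\mathbb N}$ be an arithmetic sequence, let $\mathcal I$ be a (proper) translation invariant free $P$-ideal of $\mathbb N$ and let $x\in[0,1)$. Suppose that $\mathcal I$ satisfies $(\mathrm{DL}_{\mathbf u})$ and that for every $A\in\mathcal P(\mathbb N)\setminus\mathcal I$ the following conditions hold. (a) If $A$ is $b$-bounded, then: (a1) if $A\subseteq^{\mathcal I}\mathrm{supp}(x)$, then $A\subseteq^{\mathcal I}\mathrm{supp}_b(x)$, $A+1\subseteq^{\mathcal I}\mathrm{supp}(x)$, and there exists $A'\subseteq_{\mathcal I}A$ such that $A'\subseteq\mathrm{supp}_b(x)$ and $\lim_{n\in A'}\frac{c_{n+1}+1}{b_{n+1}}=1$; (a2) if $A\cap\mathrm{supp}(x)\in\mathcal I$, then there exists $B'\subseteq_{\mathcal I}A$ such that $\lim_{n\in B'}\frac{c_{n+1}}{b_{n+1}}=0$. (b) If $A$ is $b$-divergent, then there exists $B\subseteq_{\mathcal I}A$ such that $\lim_{n\in B}\varphi\left(\frac{c_n}{b_n}\right)=0$ in $\mathbb T$. Then $\bar x\in t^{\mathcal I}_{\mathbf u}(\mathbb T)$.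
   Context: $\mathbb N=\{0,1,2,\dots\}$, $\mathbb N_+=\mathbb N\setminus\{0\}$; $\mathbb T=\mathbb R/\mathbb Z$ with canonical projection $\varphi\colon\mathbb R\to\mathbb T$, and $\bar x=\varphi(x)$. For $A\subseteq\mathbb N$ and $n\in\mathbb Z$, $A+n=\{a+n:a\in A\}$. For an infinite $A\subseteq\mathbb N$, $\lim_{n\in A}$ is the limit as $n\to\infty$ along $A$. An ideal of $\mathbb N$ is a non-empty $\mathcal I\subseteq\mathcal P(\mathbb N)$ closed under finite unions and subsets. It is proper if $\mathbb N\notin\mathcal I$; free if it contains all finite subsets of $\mathbb N$; translation invariant if $(A+n)\cap\mathbb N\in\mathcal I$ for all $A\in\mathcal I$, $n\in\mathbb Z$; a $P$-ideal if for every countable family $\{A_n:n\in\mathbb N\}\subseteq\mathcal I$ there is $U\in\mathcal I$ with $A_n\setminus U$ finite for all $n$. Write $A\subseteq^{\mathcal I}B$ if $A\setminus B\in\mathcal I$, and $A\subseteq_{\mathcal I}B$ if $A\subseteq B$ and $B\setminus A\in\mathcal I$. A sequence $(x_n)$ in $\mathbb T$ $\mathcal I$-converges to $y$ if $\{n\in\mathbb N:x_n\notin U\}\in\mathcal I$ for every neighborhood $U$ of $y$; $t^{\mathcal I}_{\mathbf u}(\mathbb T)=\{y\in\mathbb T: u_ny \ \mathcal I\text{-converges to }0\}$. A sequence $\mathbf u=(u_n)_{n\in\mathbb N}$ of integers is arithmetic if it is strictly increasing, $u_0=1$ and $u_n\mid u_{n+1}$ for all $n\in\mathbb N$; put $b_n=u_n/u_{n-1}$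 for $n\in\mathbb N_+$. Every $x\in[0,1)$ has a unique representation $x=\sum_{n=1}^\infty\frac{c_n}{u_n}$ with $c_n\in\mathbb N$, $c_n<b_n$ for all $n\in\mathbb N_+$ and $c_n<b_n-1$ for infinitely many $n$. Put $\mathrm{supp}(x)=\{n\in\mathbb N_+:c_n\ne0\}$ and $\mathrm{supp}_b(x)=\{n\in\mathbb N_+:c_n=b_n-1\}$. An infinite $A\subseteq\mathbb N$ is $b$-bounded if $(b_n)_{n\in A}$ is bounded, and $b$-divergent if $(b_n)_{n\in A}$ diverges to infinity (finite sets are regarded as both). The index $n=0$, for which $b_n$ and $c_n$ are not defined, is disregarded in these conditions and in limits. A proper free ideal $\mathcal I$ satisfies $(\mathrm{DL}_{\mathbf u})$ if for every $A\in\mathcal P(\mathbb N)\setminus\mathcal I$: if $A\setminus A'\notin\mathcal I$ for every $b$-bounded $A'\subseteq A$, then there exists a $b$-divergent $B\subseteq A$ with $B\notin\mathcal I$. *)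

theory Defs
  imports "HOL-Analysis.Analysis"
begin

section \<open>The circle group\<close>

quotient_type torus = real / "\<lambda>x y::real. x - y \<in> \<int>"
proof (rule equivpI)
  show "reflp (\<lambda>x y::real. x - y \<in> \<int>)" by (simp add: reflp_def)
  show "symp (\<lambda>x y::real. x - y \<in> \<int>)"
    by (rule sympI) (metis Ints_minus minus_diff_eq)
  show "transp (\<lambda>x y::real. x - y \<in> \<int>)"
  proof (rule transpI)
    fix x y z :: real
    assume "x - y \<in> \<int>" "y - z \<in> \<int>"
    then have "(x - y) + (y - z) \<in> \<int>" by (rule Ints_add)
    then show "x - z \<in> \<int>" by simp
  qed
qed

lift_definition proj :: "real \<Rightarrow> torus" is "\<lambda>x. x" .

instantiation torus :: ab_group_add
begin

lift_definition zero_torus :: torus is "0 :: real" .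

lift_definition plus_torus :: "torus \<Rightarrow> torus \<Rightarrow> torus" is "(+) :: real \<Rightarrow> real \<Rightarrow> real"
proof -
  fix a b c d :: real
  assume "a - b \<in> \<int>" "c - d \<in> \<int>"
  then have "(a - b) + (c - d) \<in> \<int>" by (rule Ints_add)
  then show "a + c - (b + d) \<in> \<int>" by (simp add: algebra_simps)
qed

lift_definition uminus_torus :: "torus \<Rightarrow> torus" is "uminus :: real \<Rightarrow> real"
proof -
  fix a b :: real
  assume "a - b \<in> \<int>"
  then have "- (a - b) \<in> \<int>" by (rule Ints_minus)
  then show "- a - - b \<in> \<int>" by simp
qed

lift_definition minus_torus :: "torus \<Rightarrow> torus \<Rightarrow> torus" is "(-) :: real \<Rightarrow> real \<Rightarrow> real"
proof -
  fix a b c d :: real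
  assume "a - b \<in> \<int>" "c - d \<in> \<int>"
  then have "(a - b) - (c - d) \<in> \<int>" by (rule Ints_diff)
  then show "a - c - (b - d) \<in> \<int>" by (simp add: algebra_simps)
qed

instance
  by standard (transfer; simp)+

end

text \<open>Multiplication by an integer in the abelian group \<open>\<real>/\<int>\<close>.\<close>

lift_definition int_mult :: "int \<Rightarrow> torus \<Rightarrow> torus" is "\<lambda>k x. of_int k * x"
proof -
  fix k :: int and a b :: real
  assume "a - b \<in> \<int>"
  then have "of_int k * (a - b) \<in> \<int>" by (intro Ints_mult) auto
  then show "of_int k * a - of_int k * b \<in> \<int>" by (simp add: algebra_simps)
qed

lemma int_mult_1: "int_mult 1 y = y"
  by transfer simp

lemma int_mult_add: "int_mult (k + l) y = int_mult k y + int_mult l y"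
  by transfer (simp add: algebra_simps)

text \<open>The topology is the quotient topology.\<close>

instantiation torus :: topological_space
begin

definition open_torus :: "torus set \<Rightarrow> bool" where
  "open_torus U \<longleftrightarrow> open (proj -` U)"

instance
proof
  show "open (UNIV :: torus set)" by (simp add: open_torus_def)
  show "open (S \<inter> T)" if "open S" "open T" for S T :: "torus set"
    using that by (auto simp: open_torus_def vimage_Int)
  show "open (\<Union>K)" if "\<forall>S\<in>K. open S" for K :: "torus set set"
    using that by (auto simp: open_torus_def vimage_Union)
qed

end

section \<open>Ideals of natural numbers\<close>

definition ideal_nat :: "nat set set \<Rightarrow> bool" where
  "ideal_nat I \<longleftrightarrow> I \<noteq> {} \<and> (\<forall>A\<in>I. \<forall>B\<in>I. A \<union> B \<in> I) \<and> (\<forall>A\<in>I. \<forall>B. B \<subseteq> A \<longrightarrow> B \<in> I)"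

definition proper_ideal :: "nat set set \<Rightarrow> bool" where
  "proper_ideal I \<longleftrightarrow> UNIV \<notin> I"

definition free_ideal :: "nat set set \<Rightarrow> bool" where
  "free_ideal I \<longleftrightarrow> (\<forall>F. finite F \<longrightarrow> F \<in> I)"

text \<open>\<open>translate A n\<close> is \<open>(A + n) \<inter> \<nat>\<close>.\<close>

definition translate :: "nat set \<Rightarrow> int \<Rightarrow> nat set" where
  "translate A n = {m. \<exists>a\<in>A. int m = int a + n}"

definition translation_invariant :: "nat set set \<Rightarrow> bool" where
  "translation_invariant I \<longleftrightarrow> (\<forall>A\<in>I. \<forall>n. translate A n \<in> I)"

definition P_ideal :: "nat set set \<Rightarrow> bool" where
  "P_ideal I \<longleftrightarrow> (\<forall>A :: nat \<Rightarrow> nat set. (\<forall>n. A n \<in> I) \<longrightarrow> (\<exists>U\<in>I. \<forall>n. finite (A n - U)))"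

definition almost_subset :: "nat set set \<Rightarrow> nat set \<Rightarrow> nat set \<Rightarrow> bool" where
  "almost_subset I A B \<longleftrightarrow> A - B \<in> I"

definition large_subset :: "nat set set \<Rightarrow> nat set \<Rightarrow> nat set \<Rightarrow> bool" where
  "large_subset I A B \<longleftrightarrow> A \<subseteq> B \<and> B - A \<in> I"

definition ideal_converges :: "nat set set \<Rightarrow> (nat \<Rightarrow> 'a::topological_space) \<Rightarrow> 'a \<Rightarrow> bool" where
  "ideal_converges I s y \<longleftrightarrow>
     (\<forall>U. eventually (\<lambda>z. z \<in> U) (nhds y) \<longrightarrow> {n. s n \<notin> U} \<in> I)"

definition t_subgroup :: "nat set set \<Rightarrow> (nat \<Rightarrow> int) \<Rightarrow> torus set" where
  "t_subgroup I u = {y. ideal_converges I (\<lambda>n. int_mult (u n) y) 0}"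

text \<open>The filter for limits as \<open>n \<rightarrow> \<infinity>\<close> along \<open>A\<close>. It is trivial if \<open>A\<close> is finite.\<close>

definition along :: "nat set \<Rightarrow> nat filter" where
  "along A = inf sequentially (principal A)"

section \<open>Arithmetic sequences and digit expansions\<close>

definition arithmetic_seq :: "(nat \<Rightarrow> int) \<Rightarrow> bool" where
  "arithmetic_seq u \<longleftrightarrow> strict_mono u \<and> u 0 = 1 \<and> (\<forall>n. u n dvd u (Suc n))"

text \<open>Only the ratios with \<open>n > 0\<close> are meaningful.\<close>

definition ratio :: "(nat \<Rightarrow> int) \<Rightarrow> nat \<Rightarrow> int" where
  "ratio u n = u n div u (n - 1)"

definition is_expansion :: "(nat \<Rightarrow> int) \<Rightarrow> real \<Rightarrow> (nat \<Rightarrow> nat) \<Rightarrow> bool" where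
  "is_expansion u x c \<longleftrightarrow>
     (\<forall>n>0. int (c n) < ratio u n) \<and>
     infinite {n. n > 0 \<and> int (c n) < ratio u n - 1} \<and>
     (\<lambda>n. real (c (Suc n)) / real_of_int (u (Suc n))) sums x"

text \<open>The value \<open>c 0\<close> plays no role in the expansion; it is fixed to \<open>0\<close> so that the digit
  function is unique, see \<open>expansion_ex1\<close> below.\<close>

definition digit :: "(nat \<Rightarrow> int) \<Rightarrow> real \<Rightarrow> nat \<Rightarrow> nat" where
  "digit u x = (THE c. is_expansion u x c \<and> c 0 = 0)"

definition supp :: "(nat \<Rightarrow> int) \<Rightarrow> real \<Rightarrow> nat set" where
  "supp u x = {n. n > 0 \<and> digit u x n \<noteq> 0}"

definition supp_b :: "(nat \<Rightarrow> int) \<Rightarrow> real \<Rightarrow> nat set" where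
  "supp_b u x = {n. n > 0 \<and> int (digit u x n) = ratio u n - 1}"

text \<open>Both properties hold for all finite sets.\<close>

definition b_bounded :: "(nat \<Rightarrow> int) \<Rightarrow> nat set \<Rightarrow> bool" where
  "b_bounded u A \<longleftrightarrow> bounded ((\<lambda>n. real_of_int (ratio u n)) ` (A - {0}))"

definition b_divergent :: "(nat \<Rightarrow> int) \<Rightarrow> nat set \<Rightarrow> bool" where
  "b_divergent u A \<longleftrightarrow> filterlim (\<lambda>n. real_of_int (ratio u n)) at_top (along A)"

definition DL :: "(nat \<Rightarrow> int) \<Rightarrow> nat set set \<Rightarrow> bool" where
  "DL u I \<longleftrightarrow>
     (\<forall>A. A \<notin> I \<longrightarrow>
        (\<forall>A'. A' \<subseteq> A \<and> b_bounded u A' \<longrightarrow> A - A' \<notin> I) \<longrightarrow>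
        (\<exists>B. B \<subseteq> A \<and> b_divergent u B \<and> B \<notin> I))"

section \<open>Existence and uniqueness of the expansion\<close>

lemma arithmetic_seq_pos:
  assumes "arithmetic_seq u"
  shows "u n > 0"
proof -
  have "strict_mono u"
    using assms by (simp add: arithmetic_seq_def)
  then have "u 0 \<le> u n"
    by (subst strict_mono_less_eq) auto
  then show ?thesis using assms by (simp add: arithmetic_seq_def)
qed

lemma arithmetic_seq_Suc:
  assumes "arithmetic_seq u"
  shows "u (Suc n) = ratio u (Suc n) * u n"
  using assms by (simp add: arithmetic_seq_def ratio_def)

lemma ratio_ge_2:
  assumes "arithmetic_seq u" "n > 0"
  shows "ratio u n \<ge> 2"
proof -
  obtain m where n: "n = Suc m" using assms(2) gr0_conv_Suc by blast
  have "u m < u (Suc m)"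
    using assms(1) by (simp add: arithmetic_seq_def strict_mono_less)
  then have "1 * u m < ratio u (Suc m) * u m"
    using arithmetic_seq_Suc[OF assms(1)] by simp
  then have "1 < ratio u (Suc m)"
    using arithmetic_seq_pos[OF assms(1), of m] mult_less_cancel_right_pos by blast
  then show ?thesis by (simp add: n)
qed

lemma arithmetic_seq_inverse_tendsto:
  assumes "arithmetic_seq u"
  shows "(\<lambda>n. 1 / real_of_int (u n)) \<longlonglongrightarrow> 0"
proof -
  have ge: "int n \<le> u n" for n
  proof (induction n)
    case 0
    show ?case using arithmetic_seq_pos[OF assms, of 0] by simp
  next
    case (Suc n)
    have "u n < u (Suc n)"
      using assms by (simp add: arithmetic_seq_def strict_mono_less)
    then show ?case using Suc by simp
  qed
  have "filterlim (\<lambda>n. real_of_int (u n)) at_top sequentially"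
  proof (rule filterlim_at_top_mono[OF filterlim_real_sequentially])
    have "real n \<le> real_of_int (u n)" for n
      using ge[of n] by linarith
    then show "eventually (\<lambda>n. real n \<le> real_of_int (u n)) sequentially" by simp
  qed
  then show ?thesis
    by (intro tendsto_divide_0[OF tendsto_const] filterlim_at_top_imp_at_infinity)
qed

lemma max_tail_sums:
  assumes "arithmetic_seq u"
  shows "(\<lambda>i. real_of_int (ratio u (Suc (i + N)) - 1) / real_of_int (u (Suc (i + N))))
           sums (1 / real_of_int (u N))"
proof -
  have "(\<lambda>i. 1 / real_of_int (u (i + N)) - 1 / real_of_int (u (Suc i + N)))
          sums (1 / real_of_int (u (0 + N)) - 0)"
    by (rule telescope_sums')
       (rule LIMSEQ_ignore_initial_segment[OF arithmetic_seq_inverse_tendsto[OF assms]])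
  moreover have "real_of_int (ratio u (Suc (i + N)) - 1) / real_of_int (u (Suc (i + N)))
      = 1 / real_of_int (u (i + N)) - 1 / real_of_int (u (Suc i + N))" for i
  proof -
    have "u (i + N) > 0" by (rule arithmetic_seq_pos[OF assms])
    moreover have "ratio u (Suc (i + N)) > 0"
      using ratio_ge_2[OF assms, of "Suc (i + N)"] by simp
    ultimately show ?thesis
      using arithmetic_seq_Suc[OF assms, of "i + N"] by (simp add: field_simps)
  qed
  ultimately show ?thesis by simp
qed

lemma expansion_floor:
  assumes u: "arithmetic_seq u" and c: "is_expansion u x c"
  shows "real_of_int \<lfloor>real_of_int (u N) * x\<rfloor>
           = real_of_int (u N) * (\<Sum>i<N. real (c (Suc i)) / real_of_int (u (Suc i)))"
proof -
  let ?f = "\<lambda>i. real (c (Suc i)) / real_of_int (u (Suc i))"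
  let ?g = "\<lambda>i. real_of_int (ratio u (Suc (i + N)) - 1) / real_of_int (u (Suc (i + N)))"
  define S where "S = (\<Sum>i<N. ?f i)"
  have sums: "?f sums x" using c by (simp add: is_expansion_def)
  then have tail: "(\<lambda>i. ?f (i + N)) sums (x - S)"
    unfolding S_def by (rule sums_split_initial_segment)
  have pos: "real_of_int (u n) > 0" for n
    using arithmetic_seq_pos[OF u] by simp
  have le: "?f (i + N) \<le> ?g i" for i
  proof (rule divide_right_mono)
    have "int (c (Suc (i + N))) \<le> ratio u (Suc (i + N)) - 1"
      using c by (simp add: is_expansion_def)
    then show "real (c (Suc (i + N))) \<le> real_of_int (ratio u (Suc (i + N)) - 1)"
      by linarith
    show "0 \<le> real_of_int (u (Suc (i + N)))" using pos less_imp_le by blast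
  qed
  have "infinite {n. n > 0 \<and> int (c n) < ratio u n - 1}"
    using c by (simp add: is_expansion_def)
  then obtain n where n: "n > N" "int (c n) < ratio u n - 1"
    by (auto simp: infinite_nat_iff_unbounded)
  define k where "k = n - Suc N"
  have nk: "n = Suc (k + N)" using n(1) by (simp add: k_def)
  have "real (c n) < real_of_int (ratio u n - 1)"
    using n(2) by linarith
  then have lt: "?f (k + N) < ?g k"
    using pos by (simp add: nk divide_strict_right_mono)
  have diff: "(\<lambda>i. ?g i - ?f (i + N)) sums (1 / real_of_int (u N) - (x - S))"
    by (rule sums_diff[OF max_tail_sums[OF u] tail])
  have "0 < (\<Sum>i. ?g i - ?f (i + N))"
  proof (rule suminf_pos2[where i = k])
    show "summable (\<lambda>i. ?g i - ?f (i + N))" using diff by (rule sums_summable)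
    show "0 \<le> ?g i - ?f (i + N)" for i using le[of i] by simp
    show "0 < ?g k - ?f (k + N)" using lt by simp
  qed
  then have upper: "x - S < 1 / real_of_int (u N)"
    using sums_unique[OF diff] by simp
  have lower: "0 \<le> x - S"
  proof -
    have "0 \<le> ?f (i + N)" for i
      using pos[of "Suc (i + N)"] by (intro divide_nonneg_pos) auto
    then have "0 \<le> (\<Sum>i. ?f (i + N))"
      using sums_summable[OF tail] by (intro suminf_nonneg)
    then show ?thesis using sums_unique[OF tail] by simp
  qed
  have int: "real_of_int (u M) * (\<Sum>i<M. ?f i) \<in> \<int>" for M
  proof (induction M)
    case 0
    show ?case by simp
  next
    case (Suc M)
    have "real_of_int (u (Suc M)) * (\<Sum>i<Suc M. ?f i)
        = real_of_int (ratio u (Suc M)) * (real_of_int (u M) * (\<Sum>i<M. ?f i)) + real (c (Suc M))"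
    proof -
      have "real_of_int (u (Suc M)) * ?f M = real (c (Suc M))"
        using pos[of "Suc M"] by simp
      moreover have "real_of_int (u (Suc M)) = real_of_int (ratio u (Suc M)) * real_of_int (u M)"
        using arithmetic_seq_Suc[OF u, of M] by simp
      ultimately show ?thesis by (simp add: distrib_left mult.assoc del: times_divide_eq_right)
    qed
    then show ?case using Suc by simp
  qed
  obtain z where z: "real_of_int (u N) * S = real_of_int z"
    unfolding S_def using int[of N] by (rule Ints_cases)
  have "\<lfloor>real_of_int (u N) * x\<rfloor> = z"
  proof (rule floor_unique)
    show "real_of_int z \<le> real_of_int (u N) * x"
    proof -
      have "0 \<le> real_of_int (u N) * (x - S)"
        using lower pos[of N] by (intro mult_nonneg_nonneg) auto
      then show ?thesis using z by (simp add: algebra_simps)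
    qed
    have "real_of_int (u N) * (x - S) < 1"
      using upper pos[of N] by (simp add: field_simps)
    then show "real_of_int (u N) * x < real_of_int z + 1"
      using z by (simp add: algebra_simps)
  qed
  then show ?thesis using z by (simp add: S_def)
qed

lemma expansion_digit:
  assumes u: "arithmetic_seq u" and c: "is_expansion u x c"
  shows "int (c (Suc n))
           = \<lfloor>real_of_int (u (Suc n)) * x\<rfloor> - ratio u (Suc n) * \<lfloor>real_of_int (u n) * x\<rfloor>"
proof -
  have "u (Suc n) > 0" by (rule arithmetic_seq_pos[OF u])
  then have "real_of_int \<lfloor>real_of_int (u (Suc n)) * x\<rfloor>
      = real_of_int (ratio u (Suc n)) * real_of_int \<lfloor>real_of_int (u n) * x\<rfloor> + real (c (Suc n))"
  proof -
    let ?f = "\<lambda>i. real (c (Suc i)) / real_of_int (u (Suc i))"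
    have "real_of_int (u (Suc n)) * ?f n = real (c (Suc n))"
      using \<open>u (Suc n) > 0\<close> by simp
    moreover have "real_of_int (u (Suc n)) = real_of_int (ratio u (Suc n)) * real_of_int (u n)"
      using arithmetic_seq_Suc[OF u, of n] by simp
    ultimately show ?thesis
      unfolding expansion_floor[OF u c]
      by (simp add: distrib_left mult.assoc del: times_divide_eq_right)
  qed
  then have "real_of_int \<lfloor>real_of_int (u (Suc n)) * x\<rfloor>
      = real_of_int (ratio u (Suc n) * \<lfloor>real_of_int (u n) * x\<rfloor> + int (c (Suc n)))"
    by simp
  then show ?thesis by linarith
qed

lemma expansion_exists:
  assumes u: "arithmetic_seq u" and x: "x \<in> {0..<1}"
  shows "\<exists>c. is_expansion u x c \<and> c 0 = 0"
proof -
  define fl where "fl n = \<lfloor>real_of_int (u n) * x\<rfloor>" for n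
  define d where "d n = fl (Suc n) - ratio u (Suc n) * fl n" for n
  define c where "c n = (case n of 0 \<Rightarrow> 0 | Suc m \<Rightarrow> nat (d m))" for n
  have pos: "real_of_int (u n) > 0" for n
    using arithmetic_seq_pos[OF u] by simp
  have b2: "ratio u (Suc n) \<ge> 2" for n
    by (rule ratio_ge_2[OF u]) simp
  have uS: "real_of_int (u (Suc n)) = real_of_int (ratio u (Suc n)) * real_of_int (u n)" for n
    using arithmetic_seq_Suc[OF u, of n] by simp
  have fl1: "real_of_int (fl n) \<le> real_of_int (u n) * x"
    and fl2: "real_of_int (u n) * x < real_of_int (fl n) + 1" for n
    unfolding fl_def by linarith+
  have d0: "0 \<le> d n" for n
  proof -
    have "real_of_int (ratio u (Suc n)) * real_of_int (fl n)
        \<le> real_of_int (ratio u (Suc n)) * (real_of_int (u n) * x)"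
      using fl1[of n] b2[of n] by (intro mult_left_mono) auto
    then have "real_of_int (ratio u (Suc n) * fl n) \<le> real_of_int (u (Suc n)) * x"
      by (simp add: uS mult.assoc)
    then have "ratio u (Suc n) * fl n \<le> fl (Suc n)"
      unfolding fl_def[of "Suc n"] by (simp add: le_floor_iff)
    then show ?thesis by (simp add: d_def)
  qed
  have db: "d n < ratio u (Suc n)" for n
  proof -
    have "real_of_int (ratio u (Suc n)) * (real_of_int (u n) * x)
        < real_of_int (ratio u (Suc n)) * (real_of_int (fl n) + 1)"
      using fl2[of n] b2[of n] by (intro mult_strict_left_mono) auto
    then have "real_of_int (u (Suc n)) * x < real_of_int (ratio u (Suc n) * (fl n + 1))"
      by (simp add: uS mult.assoc)
    then have "fl (Suc n) < ratio u (Suc n) * (fl n + 1)"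
      unfolding fl_def[of "Suc n"] by (simp add: floor_less_iff)
    then show ?thesis by (simp add: d_def algebra_simps)
  qed
  have cS: "int (c (Suc n)) = d n" for n
    using d0[of n] by (simp add: c_def)
  have term_eq: "real (c (Suc n)) / real_of_int (u (Suc n))
      = real_of_int (fl (Suc n)) / real_of_int (u (Suc n)) - real_of_int (fl n) / real_of_int (u n)" for n
  proof -
    have "real (c (Suc n)) = real_of_int (d n)" using cS[of n] by (metis of_int_of_nat_eq)
    moreover have "real_of_int (ratio u (Suc n)) > 0" using b2[of n] by simp
    ultimately show ?thesis
      using pos[of n] by (simp add: d_def uS field_simps)
  qed
  have lim: "(\<lambda>n. real_of_int (fl n) / real_of_int (u n)) \<longlonglongrightarrow> x"
  proof (rule real_tendsto_sandwich)
    have "x - 1 / real_of_int (u n) \<le> real_of_int (fl n) / real_of_int (u n)" for n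
    proof -
      have "x < (real_of_int (fl n) + 1) / real_of_int (u n)"
        using fl2[of n] pos[of n] by (simp add: pos_less_divide_eq mult.commute)
      then show ?thesis by (simp add: add_divide_distrib)
    qed
    then show "eventually (\<lambda>n. x - 1 / real_of_int (u n) \<le> real_of_int (fl n) / real_of_int (u n))
        sequentially" by simp
    have "real_of_int (fl n) / real_of_int (u n) \<le> x" for n
      using fl1[of n] pos[of n] by (simp add: field_simps)
    then show "eventually (\<lambda>n. real_of_int (fl n) / real_of_int (u n) \<le> x) sequentially" by simp
    show "(\<lambda>n. x - 1 / real_of_int (u n)) \<longlonglongrightarrow> x"
      using tendsto_diff[OF tendsto_const arithmetic_seq_inverse_tendsto[OF u], of x] by simp
  qed simp
  have "fl 0 = 0"
    using x u by (simp add: fl_def arithmetic_seq_def floor_eq_iff)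
  then have sums: "(\<lambda>n. real (c (Suc n)) / real_of_int (u (Suc n))) sums x"
    using telescope_sums[OF lim] by (simp add: term_eq)
  have inf: "infinite {n. n > 0 \<and> int (c n) < ratio u n - 1}"
  proof
    assume "finite {n. n > 0 \<and> int (c n) < ratio u n - 1}"
    then obtain N where N: "\<And>n. n > 0 \<Longrightarrow> int (c n) < ratio u n - 1 \<Longrightarrow> n \<le> N"
      by (auto simp: finite_nat_set_iff_bounded_le)
    have eq: "int (c (Suc (i + N))) = ratio u (Suc (i + N)) - 1" for i
      using N[of "Suc (i + N)"] db[of "i + N"] cS[of "i + N"] by force
    have "real (c (Suc (i + N))) = real_of_int (ratio u (Suc (i + N)) - 1)" for i
      using eq[of i] by (metis of_int_of_nat_eq)
    then have "(\<lambda>i. real (c (Suc (i + N))) / real_of_int (u (Suc (i + N)))) sums (1 / real_of_int (u N))"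
      using max_tail_sums[OF u, of N] by simp
    moreover have "(\<lambda>i. real (c (Suc (i + N))) / real_of_int (u (Suc (i + N))))
        sums (x - (\<Sum>i<N. real (c (Suc i)) / real_of_int (u (Suc i))))"
      using sums_split_initial_segment[OF sums, of N] by simp
    moreover have "(\<Sum>i<N. real (c (Suc i)) / real_of_int (u (Suc i)))
        = real_of_int (fl N) / real_of_int (u N)"
      unfolding term_eq using \<open>fl 0 = 0\<close>
        sum_lessThan_telescope[of "\<lambda>n. real_of_int (fl n) / real_of_int (u n)" N] by simp
    ultimately have "1 / real_of_int (u N) = x - real_of_int (fl N) / real_of_int (u N)"
      using sums_unique2 by metis
    then have "real_of_int (u N) * x = real_of_int (fl N) + 1"
      using pos[of N] by (simp add: field_simps)
    then show False using fl2[of N] by simp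
  qed
  have "int (c n) < ratio u n" if "n > 0" for n
    using that db cS by (cases n) auto
  then have "is_expansion u x c"
    using sums inf by (simp add: is_expansion_def)
  then show ?thesis by (auto simp: c_def)
qed

lemma expansion_ex1:
  assumes u: "arithmetic_seq u" and x: "x \<in> {0..<1}"
  shows "\<exists>!c. is_expansion u x c \<and> c 0 = 0"
proof (rule ex_ex1I)
  show "\<exists>c. is_expansion u x c \<and> c 0 = 0" by (rule expansion_exists[OF u x])
next
  fix c c'
  assume c: "is_expansion u x c \<and> c 0 = 0" and c': "is_expansion u x c' \<and> c' 0 = 0"
  show "c = c'"
  proof
    fix n
    show "c n = c' n"
    proof (cases n)
      case 0
      then show ?thesis using c c' by simp
    next
      case (Suc m)
      have "int (c (Suc m)) = int (c' (Suc m))"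
        using expansion_digit[OF u] c c' by metis
      then show ?thesis by (simp add: Suc)
    qed
  qed
qed

lemma digit_expansion:
  assumes "arithmetic_seq u" "x \<in> {0..<1}"
  shows "is_expansion u x (digit u x)"
  using theI'[OF expansion_ex1[OF assms]] by (simp add: digit_def)

end

theory Submission
  imports Defs
begin

text \<open>Let \<open>r\<^sub>n\<close> be the fractional part of \<open>u\<^sub>n x\<close>, so that \<open>b\<^sub>n r\<^sub>n\<^sub>-\<^sub>1 = c\<^sub>n + r\<^sub>n\<close>. If the set of \<open>n\<close> with
  \<open>\<epsilon> \<le> r\<^sub>n \<le> 1 - \<epsilon>\<close> is not in \<open>I\<close>, neither is its translate \<open>A\<close> by \<open>1\<close>. Every \<open>b\<close>-bounded subset of \<open>A\<close>
  outside the support is in \<open>I\<close>: where \<open>c\<^sub>n = 0\<close>, one has \<open>r\<^sub>n\<^sub>-\<^sub>1 \<le> r\<^sub>n / 2\<close>, and by (a2) either \<open>b\<^sub>n\<^sub>+\<^sub>1\<close> is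
  large and \<open>r\<^sub>n\<close> is small, or \<open>b\<^sub>n\<^sub>+\<^sub>1\<close> is bounded and \<open>c\<^sub>n\<^sub>+\<^sub>1 = 0\<close> again, so that the halving can be
  iterated. The same argument for \<open>1 - r\<^sub>n\<close> and the digits \<open>b\<^sub>n - 1 - c\<^sub>n\<close>, using (a1), handles the
  \<open>b\<close>-bounded subsets of the support. Hence (DL) applies to \<open>A\<close> and yields a \<open>b\<close>-divergent subset
  that is not in \<open>I\<close>, on which \<open>r\<^sub>n\<^sub>-\<^sub>1\<close> is close to \<open>c\<^sub>n / b\<^sub>n\<close>, contradicting (b).\<close>

section \<open>Ideals of natural numbers and limits along a set\<close>

lemma ideal_subset: "ideal_nat I \<Longrightarrow> A \<in> I \<Longrightarrow> B \<subseteq> A \<Longrightarrow> B \<in> I"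
  by (auto simp: ideal_nat_def)

lemma ideal_Un: "ideal_nat I \<Longrightarrow> A \<in> I \<Longrightarrow> B \<in> I \<Longrightarrow> A \<union> B \<in> I"
  by (auto simp: ideal_nat_def)

lemma ideal_vimage_Suc:
  assumes "translation_invariant I" "A \<in> I"
  shows "Suc -` A \<in> I"
proof -
  have "int m = int a + - 1 \<longleftrightarrow> a = Suc m" for m a by linarith
  then have "translate A (-1) = Suc -` A"
    by (auto simp: translate_def)
  then show ?thesis using assms by (metis translation_invariant_def)
qed

lemma ideal_image_Suc:
  assumes "translation_invariant I" "A \<in> I"
  shows "Suc ` A \<in> I"
proof -
  have "int m = int a + 1 \<longleftrightarrow> m = Suc a" for m a by linarith
  then have "translate A 1 = Suc ` A"
    by (auto simp: translate_def)
  then show ?thesis using assms by (metis translation_invariant_def)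
qed

text \<open>Since \<open>sequentially\<close> is the cofinite filter, a limit along a set misses
  each tolerance at finitely many indices only, and a free ideal absorbs these.\<close>

lemma eventually_along: "eventually P (along A) \<longleftrightarrow> finite {n \<in> A. \<not> P n}"
  unfolding along_def eventually_inf_principal cofinite_eq_sequentially[symmetric]
    eventually_cofinite not_imp by simp

section \<open>Convergence to zero in the circle group\<close>

lemma nhds_zero_torusD:
  assumes "eventually (\<lambda>z. z \<in> U) (nhds (0 :: torus))"
  shows "\<exists>e>0. \<forall>y. \<bar>y\<bar> < e \<longrightarrow> proj y \<in> U"
proof -
  obtain V where V: "open V" "0 \<in> V" "V \<subseteq> U"
    using assms by (auto simp: eventually_nhds)
  have "open (proj -` V)" using V(1) by (simp add: open_torus_def)
  moreover have "0 \<in> proj -` V"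
    using V(2) by (simp add: zero_torus_def proj_def)
  ultimately obtain e where "e > 0" "ball 0 e \<subseteq> proj -` V"
    by (meson open_contains_ball)
  then show ?thesis using V(3) by (auto simp: dist_norm subset_iff)
qed

lemma proj_eq_iff: "proj x = proj y \<longleftrightarrow> x - y \<in> \<int>"
  by transfer simp

text \<open>The preimage of the image is a union of integer translates of \<open>S\<close>, and its
  openness is what the quotient topology asks for.\<close>

lemma open_proj_image:
  assumes "open S"
  shows "open (proj ` S)"
proof -
  have "proj -` (proj ` S) = (\<Union>k. (\<lambda>y. of_int k + y) ` S)" (is "?L = ?R")
  proof
    show "?L \<subseteq> ?R"
    proof
      fix z assume "z \<in> ?L"
      then obtain y where y: "y \<in> S" "z - y \<in> \<int>" by (auto simp: proj_eq_iff)
      from y(2) obtain k where "z - y = of_int k" by (rule Ints_cases)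
      then have "z = of_int k + y" by simp
      with y(1) show "z \<in> ?R" by blast
    qed
    show "?R \<subseteq> ?L" by (force simp: proj_eq_iff)
  qed
  then show ?thesis using assms by (simp add: open_torus_def open_translation open_UN)
qed

text \<open>As \<open>proj\<close> is an open map, the image of \<open>ball 0 e\<close> is a
  neighborhood of zero; lifting back to the reals costs an integer.\<close>

lemma tendsto_proj_zeroD:
  assumes "((\<lambda>n. proj (f n)) \<longlongrightarrow> 0) F" "e > 0"
  shows "eventually (\<lambda>n. \<exists>k::int. \<bar>f n - of_int k\<bar> < e) F"
proof -
  have "0 \<in> proj ` ball 0 e"
    using assms(2) by (intro image_eqI[of _ _ 0]) (auto simp: zero_torus_def proj_def)
  then have "eventually (\<lambda>n. proj (f n) \<in> proj ` ball 0 e) F"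
    using assms(1) open_proj_image[of "ball 0 e"] by (simp add: topological_tendstoD)
  then show ?thesis
  proof eventually_elim
    case (elim n)
    then obtain y where "\<bar>y\<bar> < e" "f n - y \<in> \<int>"
      by (auto simp: proj_eq_iff)
    moreover from this(2) obtain k where "f n - y = of_int k" by (rule Ints_cases)
    ultimately show ?case by (intro exI[of _ k]) (simp add: algebra_simps)
  qed
qed

lemma ideal_converges_proj_zeroI:
  assumes "ideal_nat I" and "\<And>e. e > 0 \<Longrightarrow> {n. e \<le> frac (f n) \<and> frac (f n) \<le> 1 - e} \<in> I"
  shows "ideal_converges I (\<lambda>n. proj (f n)) 0"
  unfolding ideal_converges_def
proof (intro allI impI)
  fix U :: "torus set"
  assume "eventually (\<lambda>z. z \<in> U) (nhds 0)"
  then obtain e where e: "e > 0" "\<And>y. \<bar>y\<bar> < e \<Longrightarrow> proj y \<in> U"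
    using nhds_zero_torusD by blast
  have "e \<le> frac (f n) \<and> frac (f n) \<le> 1 - e" if "proj (f n) \<notin> U" for n
  proof (rule ccontr)
    assume "\<not> ?thesis"
    then have "\<bar>frac (f n)\<bar> < e \<or> \<bar>frac (f n) - 1\<bar> < e"
      using frac_ge_0[of "f n"] frac_lt_1[of "f n"] by linarith
    \<comment> \<open>Both reals represent the same point of the circle, so a fractional part near 1
      also counts as near zero.\<close>
    moreover have "proj (frac (f n)) = proj (f n)" "proj (frac (f n) - 1) = proj (f n)"
      by (simp_all add: proj_eq_iff frac_def)
    ultimately show False using e(2) that by metis
  qed
  then show "{n. proj (f n) \<notin> U} \<in> I"
    by (intro ideal_subset[OF assms(1) assms(2)[OF e(1)]] subsetI) simp
qed

section \<open>Remainders of the expansion and the halving argument\<close>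

lemma ratio_frac:
  assumes u: "arithmetic_seq u" and x: "x \<in> {0..<1}"
  shows "real_of_int (ratio u (Suc n)) * frac (real_of_int (u n) * x)
           = real (digit u x (Suc n)) + frac (real_of_int (u (Suc n)) * x)"
proof -
  have "real_of_int (int (digit u x (Suc n)))
      = real_of_int (\<lfloor>real_of_int (u (Suc n)) * x\<rfloor> - ratio u (Suc n) * \<lfloor>real_of_int (u n) * x\<rfloor>)"
    using expansion_digit[OF u digit_expansion[OF u x]] by simp
  then show ?thesis
    using arithmetic_seq_Suc[OF u, of n] by (simp add: frac_def algebra_simps)
qed

text \<open>Where the digit is zero, passing from \<open>r n\<close> to \<open>r (Suc n)\<close> at
  least doubles a positive remainder, which turns the bound for \<open>Suc k\<close> into the one
  for \<open>k\<close>. The slack \<open>e\<close> pays for the indices where the next ratio is too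
  large to force a zero digit. \<open>d\<close> and \<open>r\<close> are abstract so that the digits
  with their remainders and the reflected pair both fit.\<close>

lemma small_remainder:
  fixes d :: "nat \<Rightarrow> int" and r :: "nat \<Rightarrow> real"
  assumes u: "arithmetic_seq u"
    and I: "ideal_nat I" "free_ideal I" "translation_invariant I"
    and r1: "\<And>n. r n \<le> 1"
    and d0: "\<And>n. 0 \<le> d (Suc n)"
    and rec: "\<And>n. real_of_int (ratio u (Suc n)) * r n = real_of_int (d (Suc n)) + r (Suc n)"
    and step: "\<And>A. \<lbrakk>A \<notin> I; b_bounded u A; A - {n. d n = 0} \<in> I\<rbrakk> \<Longrightarrow>
      \<exists>B. large_subset I B A \<and>
        ((\<lambda>n. real_of_int (d (Suc n)) / real_of_int (ratio u (Suc n))) \<longlongrightarrow> 0) (along B)"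
    and e: "e > 0"
    and A: "b_bounded u A" "A - {n. d n = 0} \<in> I"
  shows "{n. Suc n \<in> A \<and> e + 1 / 2 ^ k < r n} \<in> I"
  using A
proof (induction k arbitrary: A)
  case 0
  have "{n. Suc n \<in> A \<and> e + 1 / 2 ^ 0 < r n} = {}"
    using r1 e by (auto simp: not_less intro: order.trans[OF r1])
  then show ?case using I(2) by (metis finite.emptyI free_ideal_def)
next
  case (Suc k)
  let ?T = "{n. Suc n \<in> A \<and> e + 1 / 2 ^ Suc k < r n}"
  show ?case
  proof (cases "A \<in> I")
    case True
    then show ?thesis
      by (rule ideal_subset[OF I(1) ideal_vimage_Suc[OF I(3)]]) auto
  next
    case False
    obtain B where B: "B \<subseteq> A" "A - B \<in> I"
      and lim: "((\<lambda>n. real_of_int (d (Suc n)) / real_of_int (ratio u (Suc n))) \<longlongrightarrow> 0) (along B)"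
      using step[OF False Suc.prems] by (auto simp: large_subset_def)
    define F where "F = {n \<in> B. \<not> real_of_int (d (Suc n)) / real_of_int (ratio u (Suc n)) < e}"
    \<comment> \<open>Off \<open>F\<close> the next digit is below \<open>e\<close> times its ratio,
      so a ratio of at most \<open>1 / e\<close> forces the digit to be zero. This makes
      \<open>C\<close> eligible for the induction hypothesis.\<close>
    define C where "C = {Suc n |n. n \<in> B - F \<and> real_of_int (ratio u (Suc n)) \<le> 1 / e}"
    have bpos: "real_of_int (ratio u (Suc n)) \<ge> 2" for n
      using ratio_ge_2[OF u, of "Suc n"] by simp
    have dlt: "real_of_int (d (Suc m)) < e * real_of_int (ratio u (Suc m))" if "m \<in> B - F" for m
    proof -
      have "real_of_int (d (Suc m)) / real_of_int (ratio u (Suc m)) < e"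
        using that by (simp add: F_def)
      then show ?thesis using bpos[of m] by (simp add: pos_divide_less_eq)
    qed
    have "finite F"
      using order_tendstoD(2)[OF lim e] by (simp add: eventually_along F_def)
    then have F: "F \<in> I" using I(2) by (simp add: free_ideal_def)
    have "b_bounded u C"
    proof -
      have "\<bar>real_of_int (ratio u n)\<bar> \<le> 1 / e" if "n \<in> C" for n
        using that by (auto simp: C_def) (use bpos in \<open>smt (verit)\<close>)
      then show ?thesis by (auto simp: b_bounded_def bounded_iff)
    qed
    moreover have "d n = 0" if nC: "n \<in> C" for n
    proof -
      obtain m where m: "n = Suc m" "m \<in> B - F" "real_of_int (ratio u (Suc m)) \<le> 1 / e"
        using nC unfolding C_def by blast
      have "real_of_int (d n) < e * real_of_int (ratio u (Suc m))"
        using dlt[OF m(2)] m(1) by simp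
      also have "\<dots> \<le> 1" using m(3) e by (simp add: field_simps)
      finally show ?thesis using d0[of m] m(1) by simp
    qed
    then have "C - {n. d n = 0} = {}" by blast
    then have "C - {n. d n = 0} \<in> I"
      using I(2) by (metis finite.emptyI free_ideal_def)
    ultimately have D: "{n. Suc n \<in> C \<and> e + 1 / 2 ^ k < r n} \<in> I" by (rule Suc.IH)
    \<comment> \<open>Outside the first three sets the digit at \<open>Suc n\<close> is zero and the
      one after it is controlled. The last set covers a small ratio at \<open>Suc (Suc n)\<close>; a
      large one is impossible.\<close>
    have "?T \<subseteq> Suc -` ((A - {n. d n = 0}) \<union> (A - B) \<union> F \<union> {n. Suc n \<in> C \<and> e + 1 / 2 ^ k < r n})"
    proof (intro subsetI vimageI2, rule ccontr)
      fix n
      assume n: "n \<in> ?T" and "Suc n \<notin> (A - {n. d n = 0}) \<union> (A - B) \<union> F \<union> {n. Suc n \<in> C \<and> e + 1 / 2 ^ k < r n}"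
      then have d: "d (Suc n) = 0" and nB: "Suc n \<in> B - F"
        and nC: "Suc (Suc n) \<notin> C \<or> r (Suc n) \<le> e + 1 / 2 ^ k" by auto
      \<comment> \<open>\<open>r\<close> has no assumed lower bound; membership in \<open>?T\<close>
        supplies the positivity that turns a ratio of at least 2 into doubling.\<close>
      have "0 < e + 1 / 2 ^ Suc k" using e by (simp add: add_pos_pos)
      then have "0 < r n" using n by simp
      then have half: "2 * r n \<le> r (Suc n)"
        using rec[of n] d mult_right_mono[OF bpos[of n], of "r n"] by simp
      have gt: "2 * e + 1 / 2 ^ k < r (Suc n)" using n half by simp
      then have "Suc (Suc n) \<notin> C" using nC e by linarith
      then have large: "1 / e < real_of_int (ratio u (Suc (Suc n)))"
        using nB by (auto simp: C_def)
      \<comment> \<open>Both the digit and the remainder, which is at most 1, are below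
        \<open>e * ?b\<close>. Hence \<open>r (Suc n) < 2 * e\<close>, against the doubled slack in
        \<open>gt\<close>.\<close>
      let ?b = "real_of_int (ratio u (Suc (Suc n)))"
      have "?b * r (Suc n) = real_of_int (d (Suc (Suc n))) + r (Suc (Suc n))" by (rule rec)
      also have "\<dots> < e * ?b + 1"
        using dlt[OF nB] r1[of "Suc (Suc n)"] by linarith
      also have "\<dots> < e * ?b + e * ?b" using large e by (simp add: field_simps)
      finally have "?b * r (Suc n) < ?b * (2 * e)" by (simp add: algebra_simps)
      then have "r (Suc n) < 2 * e" using bpos[of "Suc n"] by (simp add: mult_less_cancel_left)
      moreover have "(0::real) < 1 / 2 ^ k" by simp
      ultimately show False using gt by linarith
    qed
    moreover have "Suc -` ((A - {n. d n = 0}) \<union> (A - B) \<union> F \<union> {n. Suc n \<in> C \<and> e + 1 / 2 ^ k < r n}) \<in> I"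
      using Suc.prems(2) B(2) F D by (intro ideal_vimage_Suc[OF I(3)] ideal_Un[OF I(1)])
    ultimately show ?thesis using ideal_subset[OF I(1)] by blast
  qed
qed

text \<open>One half of \<open>e\<close> serves as the slack and the other dominates
  \<open>1 / 2 ^ k\<close> for a suitable \<open>k\<close>, so \<open>small_remainder\<close>
  captures all predecessors of elements of \<open>A\<close>.\<close>

lemma bounded_remainder_in_ideal:
  fixes d :: "nat \<Rightarrow> int" and r :: "nat \<Rightarrow> real"
  assumes u: "arithmetic_seq u"
    and I: "ideal_nat I" "free_ideal I" "translation_invariant I"
    and r1: "\<And>n. r n \<le> 1"
    and d0: "\<And>n. 0 \<le> d (Suc n)"
    and rec: "\<And>n. real_of_int (ratio u (Suc n)) * r n = real_of_int (d (Suc n)) + r (Suc n)"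
    and step: "\<And>A. \<lbrakk>A \<notin> I; b_bounded u A; A - {n. d n = 0} \<in> I\<rbrakk> \<Longrightarrow>
      \<exists>B. large_subset I B A \<and>
        ((\<lambda>n. real_of_int (d (Suc n)) / real_of_int (ratio u (Suc n))) \<longlongrightarrow> 0) (along B)"
    and e: "e > 0"
    and A: "b_bounded u A" "A - {n. d n = 0} \<in> I"
    and AE: "A \<subseteq> Suc ` {n. e \<le> r n}"
  shows "A \<in> I"
proof -
  obtain k where k: "(1 / 2) ^ k < e / 2"
    using real_arch_pow_inv[of "e / 2" "1 / 2"] e by auto
  have "{n. Suc n \<in> A \<and> e / 2 + 1 / 2 ^ k < r n} \<in> I"
    using e by (intro small_remainder[OF u I r1 d0 rec step _ A]) auto
  moreover have "A \<subseteq> Suc ` {n. Suc n \<in> A \<and> e / 2 + 1 / 2 ^ k < r n}"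
    using AE k by (force simp: power_one_over)
  ultimately show ?thesis
    using ideal_image_Suc[OF I(3)] ideal_subset[OF I(1)] by blast
qed

section \<open>Remainders that stay away from 0 and 1\<close>

theorem theorem6p9:
  fixes u :: "nat \<Rightarrow> int" and I :: "nat set set" and x :: real
  assumes "arithmetic_seq u"
    and "ideal_nat I" and "proper_ideal I" and "free_ideal I"
    and "translation_invariant I" and "P_ideal I"
    and "x \<in> {0..<1}"
    and "DL u I"
    and a1: "\<And>A. \<lbrakk>A \<notin> I; b_bounded u A; almost_subset I A (supp u x)\<rbrakk> \<Longrightarrow>
          almost_subset I A (supp_b u x) \<and>
          almost_subset I (translate A 1) (supp u x) \<and>
          (\<exists>A'. large_subset I A' A \<and> A' \<subseteq> supp_b u x \<and>
            ((\<lambda>n. (real (digit u x (n + 1)) + 1) / real_of_int (ratio u (n + 1))) \<longlongrightarrow> 1) (along A'))"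
    and a2: "\<And>A. \<lbrakk>A \<notin> I; b_bounded u A; A \<inter> supp u x \<in> I\<rbrakk> \<Longrightarrow>
          \<exists>B'. large_subset I B' A \<and>
            ((\<lambda>n. real (digit u x (n + 1)) / real_of_int (ratio u (n + 1))) \<longlongrightarrow> 0) (along B')"
    and b: "\<And>A. \<lbrakk>A \<notin> I; b_divergent u A\<rbrakk> \<Longrightarrow>
          \<exists>B. large_subset I B A \<and>
            ((\<lambda>n. proj (real (digit u x n) / real_of_int (ratio u n))) \<longlongrightarrow> 0) (along B)"
  shows "proj x \<in> t_subgroup I u"
proof -
  note u = assms(1) and I = assms(2,4,5) and x = assms(7)
  let ?b = "\<lambda>n. real_of_int (ratio u n)" and ?c = "digit u x"
  define r where "r n = frac (real_of_int (u n) * x)" for n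
  have r: "0 \<le> r n" "r n \<le> 1" for n
    using frac_lt_1[of "real_of_int (u n) * x"] by (simp_all add: r_def)
  have rec: "?b (Suc n) * r n = real (?c (Suc n)) + r (Suc n)" for n
    unfolding r_def by (rule ratio_frac[OF u x])
  have cb: "int (?c (Suc n)) < ratio u (Suc n)" for n
    using digit_expansion[OF u x] by (simp add: is_expansion_def)
  have b2: "?b (Suc n) \<ge> 2" for n
    using ratio_ge_2[OF u, of "Suc n"] by simp
  \<comment> \<open>The defect from the maximal digit: paired with \<open>1 - r n\<close>, it obeys
    the same recursion as the digits with \<open>r n\<close>.\<close>
  define d where "d n = ratio u n - 1 - int (?c n)" for n
  have fin: "F \<in> I" if "finite F" for F
    using that I(2) by (simp add: free_ideal_def)
  have "{n. e \<le> r n \<and> r n \<le> 1 - e} \<in> I" if e: "e > 0" for e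
  proof (rule ccontr)
    let ?E = "{n. e \<le> r n \<and> r n \<le> 1 - e}"
    assume "?E \<notin> I"
    then have A: "Suc ` ?E \<notin> I"
      using ideal_vimage_Suc[OF I(3), of "Suc ` ?E"] by (auto simp: inj_vimage_image_eq)
    have bdd: "A' \<in> I" if A': "A' \<subseteq> Suc ` ?E" "b_bounded u A'" for A'
    proof -
      have sub: "b_bounded u X" if "X \<subseteq> A'" for X
        using A'(2) that unfolding b_bounded_def
        by (meson Diff_mono bounded_subset image_mono order_refl)
      have out: "A' - supp u x \<in> I"
      proof (rule bounded_remainder_in_ideal[where d = "\<lambda>n. int (?c n)" and r = r and e = e, OF u I])
        show "\<exists>B. large_subset I B X \<and>
            ((\<lambda>n. real_of_int (int (?c (Suc n))) / ?b (Suc n)) \<longlongrightarrow> 0) (along B)"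
          if "X \<notin> I" "b_bounded u X" "X - {n. int (?c n) = 0} \<in> I" for X
        proof -
          have "X \<inter> supp u x \<in> I"
            using that(3) by (rule ideal_subset[OF I(1)]) (auto simp: supp_def)
          then show ?thesis using a2[OF that(1,2)] by simp
        qed
        \<comment> \<open>Index 0 is outside the support by definition, so it is the only possible
          exception.\<close>
        show "A' - supp u x - {n. int (?c n) = 0} \<in> I"
          by (rule fin, rule finite_subset[of _ "{0}"]) (auto simp: supp_def)
      qed (use A'(1) e r rec in \<open>auto intro!: sub\<close>)
      have ins: "A' \<inter> supp u x \<in> I"
      \<comment> \<open>Condition (a1) speaks only about sets outside \<open>I\<close>;
        \<open>nI\<close> makes it applicable to the part of \<open>A'\<close> in the support and
        shows its digits to be maximal up to \<open>I\<close>.\<close>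
      proof (rule ccontr)
        assume nI: "A' \<inter> supp u x \<notin> I"
        have "A' \<inter> supp u x \<in> I"
        proof (rule bounded_remainder_in_ideal[where d = d and r = "\<lambda>n. 1 - r n" and e = e, OF u I])
          show "\<exists>B. large_subset I B X \<and>
              ((\<lambda>n. real_of_int (d (Suc n)) / ?b (Suc n)) \<longlongrightarrow> 0) (along B)"
            if X: "X \<notin> I" "b_bounded u X" "X - {n. d n = 0} \<in> I" for X
          proof -
            \<comment> \<open>At a positive index off the support the digit is 0 and the ratio at
              least 2, so \<open>d\<close> is positive there.\<close>
            have "X - supp u x \<subseteq> (X - {n. d n = 0}) \<union> {0}"
            proof
              fix n assume "n \<in> X - supp u x"
              then show "n \<in> (X - {n. d n = 0}) \<union> {0}"
                using ratio_ge_2[OF u, of n] by (auto simp: supp_def d_def)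
            qed
            then have "almost_subset I X (supp u x)"
              unfolding almost_subset_def
              using ideal_subset[OF I(1)] ideal_Un[OF I(1) X(3) fin[of "{0}"]] by blast
            then obtain B where B: "large_subset I B X"
              and lim: "((\<lambda>n. (real (?c (n + 1)) + 1) / ?b (n + 1)) \<longlongrightarrow> 1) (along B)"
              using a1[OF X(1,2)] by blast
            have "real_of_int (d (Suc n)) / ?b (Suc n) = 1 - (real (?c (n + 1)) + 1) / ?b (n + 1)" for n
              using b2[of n] by (simp add: d_def field_simps)
            then show ?thesis
              using B tendsto_diff[OF tendsto_const lim, of 1] by auto
          qed
          have "A' \<inter> supp u x - supp_b u x \<in> I"
            using a1[OF nI sub] fin[of "{}"] by (simp add: almost_subset_def Diff_eq_empty_iff[THEN iffD2])
          moreover have "d n = 0" if "n \<in> supp_b u x" for n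
            using that by (simp add: d_def supp_b_def)
          then have "A' \<inter> supp u x - {n. d n = 0} \<subseteq> A' \<inter> supp u x - supp_b u x"
            by blast
          ultimately show "A' \<inter> supp u x - {n. d n = 0} \<in> I"
            by (rule ideal_subset[OF I(1)])
          show "0 \<le> d (Suc n)" for n using cb[of n] by (simp add: d_def)
          show "?b (Suc n) * (1 - r n) = real_of_int (d (Suc n)) + (1 - r (Suc n))" for n
            using rec[of n] by (simp add: d_def algebra_simps)
        qed (use A'(1) e r in \<open>auto intro!: sub\<close>)
        then show False using nI by simp
      qed
      show ?thesis using ideal_Un[OF I(1) out ins] by (simp add: Un_Diff_Int)
    qed
    have "Suc ` ?E - A' \<notin> I" if "A' \<subseteq> Suc ` ?E \<and> b_bounded u A'" for A'
      using ideal_Un[OF I(1) bdd, of A' "Suc ` ?E - A'"] that A by (auto simp: Un_absorb1)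
    then obtain B where B: "B \<subseteq> Suc ` ?E" "b_divergent u B" "B \<notin> I"
      using assms(8) A unfolding DL_def by meson
    then obtain B1 where B1: "large_subset I B1 B"
      and lim: "((\<lambda>n. proj (real (?c n) / ?b n)) \<longlongrightarrow> 0) (along B1)"
      using b by blast
    \<comment> \<open>A single good index will give the contradiction, and an infinite
      \<open>B1\<close> survives the removal of two finite exceptional sets.\<close>
    have "infinite B1"
      using B1 B(3) ideal_Un[OF I(1) fin[of B1], of "B - B1"]
      by (auto simp: large_subset_def Un_absorb1)
    \<comment> \<open>A ratio above \<open>2 / e\<close> gives \<open>r n / ?b n < e / 2\<close>;
      the other half of \<open>e\<close> bounds the distance of \<open>?c n / ?b n\<close> to an
      integer.\<close>
    moreover have "finite {n \<in> B. \<not> 2 / e < ?b n}"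
      using B(2) unfolding b_divergent_def filterlim_at_top_dense eventually_along by blast
    moreover have "finite {n \<in> B1. \<not> (\<exists>k::int. \<bar>real (?c n) / ?b n - of_int k\<bar> < e / 2)}"
      using tendsto_proj_zeroD[OF lim, of "e / 2"] e by (simp add: eventually_along)
    ultimately have "infinite (B1 - ({n \<in> B. \<not> 2 / e < ?b n} \<union>
        {n \<in> B1. \<not> (\<exists>k::int. \<bar>real (?c n) / ?b n - of_int k\<bar> < e / 2)}))"
      by (intro Diff_infinite_finite finite_UnI)
    then obtain n where n': "n \<in> B1 - ({n \<in> B. \<not> 2 / e < ?b n} \<union>
        {n \<in> B1. \<not> (\<exists>k::int. \<bar>real (?c n) / ?b n - of_int k\<bar> < e / 2)})"
      using infinite_imp_nonempty by blast
    then have n: "n \<in> B1" "n \<notin> {n \<in> B. \<not> 2 / e < ?b n}" by simp_all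
    obtain k :: int where k: "\<bar>real (?c n) / ?b n - of_int k\<bar> < e / 2"
      using n' by blast
    have "n \<in> B" using n(1) B1 by (auto simp: large_subset_def)
    then obtain m where m: "n = Suc m" "e \<le> r m" "r m \<le> 1 - e" using B(1) by auto
    have large: "2 / e < ?b n" using n(2) \<open>n \<in> B\<close> by simp
    have "r n / ?b n < e / 2"
    proof -
      have "r n * 2 \<le> 2" using r(2)[of n] by simp
      also have "2 < e * ?b n" using large e by (simp add: field_simps)
      finally show ?thesis using b2[of m] m(1) by (simp add: field_simps)
    qed
    moreover have "0 \<le> r n / ?b n" using r(1) b2[of m] m(1) by simp
    moreover have "r m = real (?c n) / ?b n + r n / ?b n"
      using rec[of m] b2[of m] m(1) by (simp add: field_simps)
    ultimately have "\<bar>r m - of_int k\<bar> < e" using k by linarith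
    \<comment> \<open>A number between \<open>e\<close> and \<open>1 - e\<close> has distance at
      least \<open>e\<close> from every integer, whether it is at most 0 or at least 1.\<close>
    moreover have "real_of_int k \<le> 0 \<or> 1 \<le> real_of_int k" by (cases "k \<le> 0") simp_all
    ultimately show False using m(2,3) by linarith
  qed
  then have "ideal_converges I (\<lambda>n. proj (real_of_int (u n) * x)) 0"
    unfolding r_def by (rule ideal_converges_proj_zeroI[OF I(1)])
  moreover have "int_mult (u n) (proj x) = proj (real_of_int (u n) * x)" for n
    by transfer simp
  ultimately show ?thesis by (simp add: t_subgroup_def)
qed

end
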